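(* Let $0<\alpha\le1$ and let $f\in\mathcal{G}(\alpha)$, with initial logarithmic coefficients $\gamma_1,\gamma_2$. Then $$-\frac{\alpha(17-\alpha)}{12(8-\alpha)}\le|\gamma_2|-|\gamma_1|\le\frac{\alpha}{12}.$$ The right-hand side inequality is sharp: for each $0<\alpha\le1$ there is a function in $\mathcal{G}(\alpha)$ for which $|\gamma_2|-|\gamma_1|=\frac{\alpha}{12}$.
   Context: Let $\mathbb{D}=\{z\in\mathbb{C}:|z|<1\}$ and let $\mathcal{A}$ be the class of functions $f$ analytic in $\mathbb{D}$ with $f(0)=0$, $f'(0)=1$, i.e. $f(z)=z+a_2z^2+a_3z^3+\cdots$. The logarithmic coefficients $\gamma_n$ of $f$ are defined by $\log\frac{f(z)}{z}=2\sum_{n=1}^\infty\gamma_nz^n$ (near $z=0$, with the branch vanishing at $0$); in particular $\gamma_1=\frac{a_2}{2}$ and $\gamma_2=\frac12\left(a_3-\frac12a_2^2\right)$. For $0<\alpha\le1$, $$\mathcal{G}(\alpha)=\left\{f\in\mathcal{A}:\ \operatorname{Re}\left[1+\frac{zf''(z)}{f'(z)}\right]<1+\frac{\alpha}{2},\ z\in\mathbb{D}\right\},$$ where the condition is understood to include that the bracketed expression is analytic in $\mathbb{D}$ (i.e. $f'\neq0$ in $\mathbb{D}$). *)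

theory Defs
  imports "HOL-Complex_Analysis.Complex_Analysis"
begin

definition class_A :: "(complex \<Rightarrow> complex) set" where
  "class_A = {f. f holomorphic_on ball 0 1 \<and> f 0 = 0 \<and> deriv f 0 = 1}"

(* As division by zero yields zero, f' \<noteq> 0 has to be required explicitly. *)
definition class_G :: "real \<Rightarrow> (complex \<Rightarrow> complex) set" where
  "class_G \<alpha> = {f \<in> class_A. \<forall>z \<in> ball 0 1.
     deriv f z \<noteq> 0 \<and> Re (1 + z * deriv (deriv f) z / deriv f z) < 1 + \<alpha> / 2}"

(* Since f z / z tends to 1 as z tends to 0, the principal branch Ln is, near 0, the
   branch of the logarithm that vanishes at 0; the value 0 = Ln 1 fills in the removable
   singularity. The factor 2 comes from the normalisation log (f z / z) = 2 * (SUM n>=1. gamma_n * z^n). *)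
definition log_coeff :: "(complex \<Rightarrow> complex) \<Rightarrow> nat \<Rightarrow> complex" where
  "log_coeff f n = (deriv ^^ n) (\<lambda>z. if z = 0 then 0 else Ln (f z / z)) 0 / fact n / 2"

lemma log_coeff_sums:
  assumes "f \<in> class_A"
  shows "eventually (\<lambda>z. (\<lambda>n. 2 * log_coeff f (Suc n) * z ^ Suc n) sums Ln (f z / z)) (at 0)"
proof -
  define g where "g = (\<lambda>z. if z = 0 then 1 else f z / z)"
  define l where "l = (\<lambda>z. if z = 0 then 0 else Ln (f z / z))"
  have f: "f holomorphic_on ball 0 1" "f 0 = 0" "deriv f 0 = 1"
    using assms by (auto simp: class_A_def)
  have "(\<lambda>z. if z = 0 then deriv f 0 else (f z - f 0) / (z - 0)) holomorphic_on ball 0 1"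
    by (rule pole_lemma_open) (use f in auto)
  moreover have "(\<lambda>z. if z = 0 then deriv f 0 else (f z - f 0) / (z - 0)) = g"
    using f by (auto simp: g_def)
  ultimately have g: "g holomorphic_on ball 0 1" by simp
  have "isCont g 0"
    using g holomorphic_on_imp_continuous_on continuous_on_interior by fastforce
  then have "\<exists>d>0. \<forall>z. dist z 0 < d \<longrightarrow> dist (g z) (g 0) < 1"
    unfolding continuous_at_eps_delta by (metis zero_less_one)
  then obtain d where d: "d > 0" "\<And>z. z \<in> ball 0 d \<Longrightarrow> g z \<in> ball 1 1"
    by (auto simp: g_def dist_commute)
  have npos: "g z \<notin> \<real>\<^sub>\<le>\<^sub>0" if "z \<in> ball 0 d" for z
  proof
    assume "g z \<in> \<real>\<^sub>\<le>\<^sub>0"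
    then have "Re (1 - g z) \<ge> 1" by (auto simp: complex_nonpos_Reals_iff)
    then have "norm (1 - g z) \<ge> 1" using complex_Re_le_cmod order_trans by blast
    with d(2)[OF that] show False by (auto simp: dist_norm)
  qed
  define r where "r = min d 1"
  have r: "r > 0" using d by (auto simp: r_def)
  have "(\<lambda>z. Ln (g z)) holomorphic_on ball 0 r"
    by (rule holomorphic_on_Ln') 
      (use npos in \<open>auto simp: r_def intro: holomorphic_on_subset[OF g]\<close>)
  moreover have "(\<lambda>z. Ln (g z)) = l"
    by (auto simp: g_def l_def)
  ultimately have l: "l holomorphic_on ball 0 r" by simp
  have "(\<lambda>n. 2 * log_coeff f (Suc n) * z ^ Suc n) sums Ln (f z / z)"
    if z: "z \<in> ball 0 r" "z \<noteq> 0" for z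
  proof -
    have "(\<lambda>n. (deriv ^^ n) l 0 / fact n * (z - 0) ^ n) sums l z"
      by (rule holomorphic_power_series[OF l z(1)])
    then have "(\<lambda>n. 2 * log_coeff f n * z ^ n) sums l z"
      by (simp add: log_coeff_def l_def)
    moreover have "log_coeff f 0 = 0" by (simp add: log_coeff_def)
    ultimately show ?thesis
      using z by (subst sums_Suc_iff) (simp add: l_def)
  qed
  then show ?thesis
    unfolding eventually_at using r by (intro exI[of _ r]) (auto simp: dist_commute)
qed

end

theory Submission
  imports Defs
begin

text \<open>
  For \<open>f\<close> in the class put \<open>g = f'' / f'\<close>. The half-plane condition \<open>Re (z g z) < \<alpha> / 2\<close> says that
  \<open>z g z / (z g z - \<alpha>)\<close> is a Schwarz function \<open>c\<^sub>1 z + c\<^sub>2 z\<^sup>2 + \<dots>\<close>, and comparing coefficients gives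
  \<open>\<gamma>\<^sub>1 = - \<alpha> c\<^sub>1 / 4\<close> and \<open>\<gamma>\<^sub>2 = - \<alpha> / 12 (c\<^sub>2 + (1 - \<alpha> / 4) c\<^sub>1\<^sup>2)\<close>. By Schwarz--Pick
  \<open>\<bar>c\<^sub>2\<bar> \<le> 1 - \<bar>c\<^sub>1\<bar>\<^sup>2\<close>, so both bounds become inequalities for quadratics in \<open>\<bar>c\<^sub>1\<bar>\<close>; the lower one
  comes from completing the square. Equality on the right holds for \<open>c\<^sub>1 = 0\<close>, \<open>c\<^sub>2 = 1\<close>, that is, for
  the Schwarz function \<open>z\<^sup>2\<close> and \<open>f' z = (1 - z\<^sup>2) powr (\<alpha> / 2)\<close>.
\<close>

section \<open>The Schwarz--Pick inequality at the origin\<close>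

text \<open>Composing \<open>h\<close> with the disc automorphism that sends \<open>h 0\<close> to 0
  gives a function to which the Schwarz lemma applies. Its derivative at 0 is
  \<open>deriv h 0\<close> divided by the real number
  \<open>1 - (norm (h 0))\<^sup>2\<close>.\<close>

lemma norm_deriv_0_le_one_minus_norm_square:
  assumes hol: "h holomorphic_on ball 0 1" and le: "\<And>z. norm z < 1 \<Longrightarrow> norm (h z) \<le> 1"
  shows "norm (deriv h 0) \<le> 1 - (norm (h 0))\<^sup>2"
proof (cases "\<exists>w. norm w < 1 \<and> norm (h w) = 1")
  case True
  then obtain w where w: "norm w < 1" "norm (h w) = 1" by blast
  \<comment> \<open>If the modulus reaches 1 inside the disc, the maximum principle makes
    \<open>h\<close> constant, and both sides of the claim are 0. The automorphism argument needs
    values in the open disc.\<close>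
  have "h constant_on ball 0 1"
  proof (rule Schwarz2[OF hol, of "1 - norm w" w])
    show sub: "ball w (1 - norm w) \<subseteq> ball 0 1"
      by (simp add: ball_subset_ball_iff)
    show "norm (h z) \<le> norm (h w)" if "norm (w - z) < 1 - norm w" for z
      using le[of z] sub that w by (auto simp: subset_eq dist_norm)
  qed (use w in auto)
  then obtain c where c: "\<And>z. z \<in> ball 0 1 \<Longrightarrow> h z = c"
    by (auto simp: constant_on_def)
  have "deriv h 0 = deriv (\<lambda>_. c) 0"
    using eventually_nhds_in_open[of "ball 0 1" "0::complex"] c
    by (intro deriv_cong_ev refl) (auto elim: eventually_mono)
  with c w show ?thesis by simp
next
  case False
  with le have less: "norm (h z) < 1" if "norm z < 1" for z
    using that order_le_less by blast
  define \<phi> where "\<phi> = (\<lambda>z. Moebius_function 0 (h 0) (h z))"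
  have h0: "norm (h 0) < 1" using less by simp
  have "Moebius_function 0 (h 0) \<circ> h holomorphic_on ball 0 1"
    by (rule holomorphic_on_compose_gen[OF hol Moebius_function_holomorphic[OF h0]])
       (use less in auto)
  then have "\<phi> holomorphic_on ball 0 1" by (simp add: \<phi>_def o_def)
  then have bound: "norm (deriv \<phi> 0) \<le> 1"
    by (rule Schwarz_Lemma(2)[where \<xi> = 0])
       (use less h0 in \<open>auto simp: \<phi>_def Moebius_function_eq_zero Moebius_function_norm_lt_1\<close>)
  have pos: "(norm (h 0))\<^sup>2 < 1"
    using h0 by (simp add: power_less_one_iff)
  have cn: "1 - cnj (h 0) * h 0 = of_real (1 - (norm (h 0))\<^sup>2)"
    by (simp add: complex_norm_square[symmetric] mult.commute)
  then have nz: "1 - cnj (h 0) * h 0 \<noteq> 0" 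
    using pos by (simp only: of_real_eq_0_iff) 
  have dh: "(h has_field_derivative deriv h 0) (at 0)"
    by (rule holomorphic_derivI[OF hol]) auto
  have "((\<lambda>z. (h z - h 0) / (1 - cnj (h 0) * h z)) has_field_derivative
      deriv h 0 / (1 - cnj (h 0) * h 0)) (at 0)"
    by (rule derivative_eq_intros dh refl nz | simp add: nz)+
  then have "deriv \<phi> 0 = deriv h 0 / of_real (1 - (norm (h 0))\<^sup>2)"
    unfolding \<phi>_def Moebius_function_simple cn by (rule DERIV_imp_deriv)
  then have "norm (deriv h 0) / \<bar>1 - (norm (h 0))\<^sup>2\<bar> \<le> 1"
    using bound by (simp only: norm_divide norm_of_real)
  then show ?thesis using pos by (simp add: divide_le_eq)
qed

section \<open>Logarithmic coefficients in terms of f''/f'\<close>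

lemma log_coeff_1_2:
  assumes f: "f \<in> class_A"
  shows "log_coeff f 1 = (deriv ^^ 2) f 0 / 4"
    and "log_coeff f 2 = (deriv ^^ 3) f 0 / 12 - ((deriv ^^ 2) f 0)\<^sup>2 / 16"
proof -
  define k where "k = (\<lambda>z. if z = 0 then 1 else f z / z)"
  \<comment> \<open>On this neighbourhood of 0 the quotient \<open>k\<close> avoids the branch cut
    of \<open>Ln\<close>.\<close>
  define S where "S = ball 0 1 \<inter> k -` (- \<real>\<^sub>\<le>\<^sub>0)"
  have f': "f holomorphic_on ball 0 1" "f 0 = 0" "deriv f 0 = 1"
    using f by (auto simp: class_A_def)
  have "k = (\<lambda>z. if z = 0 then deriv f 0 else (f z - f 0) / (z - 0))"
    using f' by (auto simp: k_def)
  then have k: "k holomorphic_on ball 0 1"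
    by (simp only: pole_lemma_open[OF f'(1) open_ball])
  have S: "open S" "0 \<in> S" "S \<subseteq> ball 0 1" and npos: "\<And>z. z \<in> S \<Longrightarrow> k z \<notin> \<real>\<^sub>\<le>\<^sub>0"
    unfolding S_def
    using continuous_open_preimage[OF holomorphic_on_imp_continuous_on[OF k], of "- \<real>\<^sub>\<le>\<^sub>0"]
    by (auto simp: closed_nonpos_Reals_complex open_Compl k_def)
  have nz: "k z \<noteq> 0" if "z \<in> S" for z using npos[OF that] by auto
  have kS: "k holomorphic_on S" using k S(3) by (rule holomorphic_on_subset)

  \<comment> \<open>Apply the Leibniz rule to f = z k. At 0 only the first derivative of the
    identity is nonzero, so for n >= 1 the sum reduces to n times the (n-1)-st derivative of
    \<open>k\<close>.\<close>
  have mult: "(deriv ^^ n) f 0 =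
      (\<Sum>i = 0..n. of_nat (n choose i) * (deriv ^^ i) (\<lambda>z. z) 0 * (deriv ^^ (n - i)) k 0)" for n
  proof -
    have "(deriv ^^ n) f 0 = (deriv ^^ n) (\<lambda>z. z * k z) 0"
      by (rule higher_deriv_transform_within_open[OF f'(1) _ open_ball])
         (use f' in \<open>auto simp: k_def intro!: holomorphic_intros k[unfolded k_def]\<close>)
    also have "\<dots> = (\<Sum>i = 0..n. of_nat (n choose i) * (deriv ^^ i) (\<lambda>z. z) 0 * (deriv ^^ (n - i)) k 0)"
      by (rule higher_deriv_mult[OF _ k open_ball]) (auto intro: holomorphic_intros)
    finally show ?thesis .
  qed
  have f2: "(deriv ^^ 2) f 0 = 2 * deriv k 0"
    using mult[of 2] by (simp add: eval_nat_numeral)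
  have f3: "(deriv ^^ 3) f 0 = 3 * deriv (deriv k) 0"
    using mult[of 3] by (simp add: eval_nat_numeral)

  define l where "l = (\<lambda>z. Ln (k z))"
  have dl: "deriv l z = deriv k z / k z" if "z \<in> S" for z
  proof -
    have "(l has_field_derivative deriv k z / k z) (at z)"
      unfolding l_def
      by (rule derivative_eq_intros holomorphic_derivI[OF kS S(1) that] npos[OF that] refl)+
        (simp add: field_simps)
    then show ?thesis by (rule DERIV_imp_deriv)
  qed
  have "(deriv k has_field_derivative deriv (deriv k) 0) (at 0)"
    by (rule holomorphic_derivI[OF holomorphic_deriv[OF kS S(1)] S(1,2)])
  moreover have "(k has_field_derivative deriv k 0) (at 0)"
    by (rule holomorphic_derivI[OF kS S(1,2)])
  ultimately have "((\<lambda>z. deriv k z / k z) has_field_derivative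
      (deriv (deriv k) 0 * k 0 - deriv k 0 * deriv k 0) / (k 0 * k 0)) (at 0)"
    by (rule DERIV_divide) (use nz S in auto)
  then have "deriv (\<lambda>z. deriv k z / k z) 0 = deriv (deriv k) 0 - (deriv k 0)\<^sup>2"
    by (simp add: DERIV_imp_deriv k_def power2_eq_square)
  moreover have "deriv (deriv l) 0 = deriv (\<lambda>z. deriv k z / k z) 0"
    using eventually_nhds_in_open[OF S(1,2)] dl
    by (intro deriv_cong_ev refl) (auto elim: eventually_mono)
  ultimately have l2: "deriv (deriv l) 0 = deriv (deriv k) 0 - (deriv k 0)\<^sup>2"
    by simp
  have l1: "deriv l 0 = deriv k 0"
    using dl[OF S(2)] by (simp add: k_def)
  \<comment> \<open>The value 0 prescribed at the origin is \<open>Ln (k 0)\<close> =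
    \<open>Ln 1\<close>, so the two functions agree everywhere.\<close>
  have l: "(\<lambda>z. if z = 0 then 0 else Ln (f z / z)) = l"
    by (auto simp: l_def k_def)
  show "log_coeff f 1 = (deriv ^^ 2) f 0 / 4"
    using l1 f2 by (simp add: log_coeff_def l)
  show "log_coeff f 2 = (deriv ^^ 3) f 0 / 12 - ((deriv ^^ 2) f 0)\<^sup>2 / 16"
    unfolding f2 f3 log_coeff_def l
    using l2 by (simp add: eval_nat_numeral field_simps)
qed

text \<open>As f'(0) = 1, the quotient rule gives f''(0) = g(0) and f'''(0) = g'(0) + g(0)^2. This
  moves the coefficients to \<open>g\<close>, the function that the half-plane condition
  controls.\<close>

lemma log_coeff_pre_schwarzian:
  assumes f: "f \<in> class_A" and nz: "\<And>z. norm z < 1 \<Longrightarrow> deriv f z \<noteq> 0"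
  defines "g \<equiv> \<lambda>z. deriv (deriv f) z / deriv f z"
  shows "g holomorphic_on ball 0 1"
    and "log_coeff f 1 = g 0 / 4"
    and "log_coeff f 2 = deriv g 0 / 12 + (g 0)\<^sup>2 / 48"
proof -
  have f': "f holomorphic_on ball 0 1" "deriv f 0 = 1"
    using f by (auto simp: class_A_def)
  have d1: "deriv f holomorphic_on ball 0 1"
    by (rule holomorphic_deriv[OF f'(1) open_ball])
  have d2: "deriv (deriv f) holomorphic_on ball 0 1"
    by (rule holomorphic_deriv[OF d1 open_ball])
  show "g holomorphic_on ball 0 1"
    unfolding g_def using nz by (intro holomorphic_intros d1 d2) auto
  have "(deriv (deriv f) has_field_derivative deriv (deriv (deriv f)) 0) (at 0)"
    by (rule holomorphic_derivI[OF d2 open_ball]) simp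
  moreover have "(deriv f has_field_derivative deriv (deriv f) 0) (at 0)"
    by (rule holomorphic_derivI[OF d1 open_ball]) simp
  ultimately have "(g has_field_derivative (deriv (deriv (deriv f)) 0 * deriv f 0 -
      deriv (deriv f) 0 * deriv (deriv f) 0) / (deriv f 0 * deriv f 0)) (at 0)"
    unfolding g_def by (rule DERIV_divide) (use nz in auto)
  then have "deriv g 0 = deriv (deriv (deriv f)) 0 - (deriv (deriv f) 0)\<^sup>2"
    by (simp add: DERIV_imp_deriv f' power2_eq_square)
  then show "log_coeff f 1 = g 0 / 4" "log_coeff f 2 = deriv g 0 / 12 + (g 0)\<^sup>2 / 48"
    unfolding log_coeff_1_2[OF f] by (simp_all add: g_def f' eval_nat_numeral diff_divide_distrib)
qed

section \<open>Schwarz functions and the two bounds\<close>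

lemma class_G_schwarz_coeffs:
  assumes \<alpha>: "0 < \<alpha>" and f: "f \<in> class_G \<alpha>"
  obtains c1 c2 :: complex where "norm c1 \<le> 1" "norm c2 \<le> 1 - (norm c1)\<^sup>2"
    "log_coeff f 1 = of_real (- (\<alpha> / 4)) * c1"
    "log_coeff f 2 = of_real (- (\<alpha> / 12)) * (c2 + of_real (1 - \<alpha> / 4) * c1\<^sup>2)"
proof -
  define g where "g = (\<lambda>z. deriv (deriv f) z / deriv f z)"
  have A: "f \<in> class_A" and nz: "\<And>z. norm z < 1 \<Longrightarrow> deriv f z \<noteq> 0"
    and re: "\<And>z. norm z < 1 \<Longrightarrow> Re (z * g z) < \<alpha> / 2"
    using f by (auto simp: class_G_def g_def)
  have g: "g holomorphic_on ball 0 1" "log_coeff f 1 = g 0 / 4"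
    "log_coeff f 2 = deriv g 0 / 12 + (g 0)\<^sup>2 / 48"
    unfolding g_def using log_coeff_pre_schwarzian[OF A] nz by blast+
  have den: "z * g z - \<alpha> \<noteq> 0" if "norm z < 1" for z
  proof
    assume "z * g z - \<alpha> = 0"
    then have "Re (z * g z) = \<alpha>" by simp
    with re[OF that] \<alpha> show False by simp
  qed
  \<comment> \<open>This is the Schwarz function with its factor z already cancelled, so no
    singularity at 0 has to be removed; c1 and c2 will be \<open>h 0\<close> and
    \<open>deriv h 0\<close>.\<close>
  define h where "h = (\<lambda>z. g z / (z * g z - \<alpha>))"
  have h: "h holomorphic_on ball 0 1"
    unfolding h_def using den by (intro holomorphic_intros g(1)) auto
  have less: "norm (z * h z) < 1" if "norm z < 1" for z
  proof -
    \<comment> \<open>The line Re w = \<alpha>/2 is the perpendicular bisector of 0 and \<alpha>, so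
      \<open>z * g z\<close> lies closer to 0 than to \<alpha>.\<close>
    have "(norm (z * g z))\<^sup>2 < (norm (z * g z - \<alpha>))\<^sup>2"
      using mult_strict_left_mono[OF re[OF that] \<alpha>]
      unfolding cmod_power2 by (simp add: power2_eq_square algebra_simps)
    then have "norm (z * g z) < norm (z * g z - \<alpha>)"
      by (rule power2_less_imp_less) simp
    moreover have "norm (z * h z) = norm (z * g z) / norm (z * g z - \<alpha>)"
      by (simp add: h_def norm_mult norm_divide)
    ultimately show ?thesis using den[OF that] by (simp add: divide_less_eq)
  qed
  have zh: "(\<lambda>z. z * h z) holomorphic_on ball 0 1"
    by (intro holomorphic_intros h)
  have h0: "((\<lambda>z. z * h z) has_field_derivative h 0) (at 0)"
    by (rule derivative_eq_intros holomorphic_derivI[OF h open_ball] refl | simp)+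
  \<comment> \<open>The Schwarz lemma for \<open>z * h z\<close>: its growth bound serves z \<noteq>
    0, its derivative bound serves z = 0.\<close>
  have le: "norm (h z) \<le> 1" if "norm z < 1" for z
  proof (cases "z = 0")
    case True
    then show ?thesis
      using Schwarz_Lemma(2)[OF zh _ less, of 0] DERIV_imp_deriv[OF h0] by simp
  next
    case False
    then show ?thesis
      using Schwarz_Lemma(1)[OF zh _ less that] by (simp add: norm_mult)
  qed
  have dg: "(g has_field_derivative deriv g 0) (at 0)"
    by (rule holomorphic_derivI[OF g(1) open_ball]) simp
  have "((\<lambda>z. z * g z - \<alpha>) has_field_derivative g 0) (at 0)"
    by (rule derivative_eq_intros dg refl | simp)+
  with dg have "(h has_field_derivative
      (deriv g 0 * (0 * g 0 - \<alpha>) - g 0 * g 0) / ((0 * g 0 - \<alpha>) * (0 * g 0 - \<alpha>))) (at 0)"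
    unfolding h_def by (rule DERIV_divide) (use \<alpha> in auto)
  then have dh: "deriv h 0 = (deriv g 0 * (- \<alpha>) - g 0 * g 0) / (\<alpha> * \<alpha>)"
    by (simp add: DERIV_imp_deriv)
  have h0_eq: "h 0 = - g 0 / \<alpha>" by (simp add: h_def)
  show thesis
  proof (rule that)
    show "norm (h 0) \<le> 1" using le by simp
    show "norm (deriv h 0) \<le> 1 - (norm (h 0))\<^sup>2"
      by (rule norm_deriv_0_le_one_minus_norm_square[OF h le])
    show "log_coeff f 1 = of_real (- (\<alpha> / 4)) * h 0"
      using \<alpha> unfolding g h0_eq by simp
    show "log_coeff f 2 = of_real (- (\<alpha> / 12)) * (deriv h 0 + of_real (1 - \<alpha> / 4) * (h 0)\<^sup>2)"
      using \<alpha> unfolding g dh h0_eq by (simp add: field_simps power2_eq_square)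
  qed
qed

lemma class_G_log_coeff_bounds:
  assumes \<alpha>: "0 < \<alpha>" "\<alpha> \<le> 1" and f: "f \<in> class_G \<alpha>"
  shows "- (\<alpha> * (17 - \<alpha>) / (12 * (8 - \<alpha>))) \<le> norm (log_coeff f 2) - norm (log_coeff f 1)"
    and "norm (log_coeff f 2) - norm (log_coeff f 1) \<le> \<alpha> / 12"
proof -
  obtain c1 c2 :: complex where c: "norm c1 \<le> 1" "norm c2 \<le> 1 - (norm c1)\<^sup>2"
    "log_coeff f 1 = of_real (- (\<alpha> / 4)) * c1"
    "log_coeff f 2 = of_real (- (\<alpha> / 12)) * (c2 + of_real (1 - \<alpha> / 4) * c1\<^sup>2)"
    using class_G_schwarz_coeffs[OF \<alpha>(1) f] by blast
  define x where "x = norm c1"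
  define N where "N = norm (c2 + of_real (1 - \<alpha> / 4) * c1\<^sup>2)"
  have x: "0 \<le> x" "x \<le> 1" using c by (auto simp: x_def)
  have "norm (log_coeff f 1) = \<bar>- (\<alpha> / 4)\<bar> * x"
    by (simp only: c(3) norm_mult x_def norm_of_real)
  moreover have "norm (log_coeff f 2) = \<bar>- (\<alpha> / 12)\<bar> * N"
    by (simp only: c(4) norm_mult N_def norm_of_real)
  \<comment> \<open>With the factor \<alpha>/12 taken out, it remains to bound
    \<open>N - 3 * x\<close> on both sides.\<close>
  ultimately have diff: "norm (log_coeff f 2) - norm (log_coeff f 1) = \<alpha> / 12 * (N - 3 * x)"
    using \<alpha> by (simp add: algebra_simps)
  have t: "norm (of_real (1 - \<alpha> / 4) * c1\<^sup>2) = (1 - \<alpha> / 4) * x\<^sup>2"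
    unfolding x_def norm_mult norm_power norm_of_real using \<alpha> by simp
  have "N \<le> norm c2 + (1 - \<alpha> / 4) * x\<^sup>2"
    unfolding N_def t[symmetric] by (rule norm_triangle_ineq)
  also have "\<dots> \<le> 1 - \<alpha> / 4 * x\<^sup>2"
    using c(2) by (simp add: x_def algebra_simps)
  also have "\<dots> \<le> 1" using \<alpha> by simp
  finally have "N - 3 * x \<le> 1" using x by simp
  then show "norm (log_coeff f 2) - norm (log_coeff f 1) \<le> \<alpha> / 12"
    using \<alpha> mult_left_mono[of "N - 3 * x" 1 "\<alpha> / 12"] unfolding diff by simp
  \<comment> \<open>The reverse triangle inequality together with |c2| \<le> 1 - x^2 leaves a
    quadratic in x alone.\<close>
  have "(1 - \<alpha> / 4) * x\<^sup>2 - norm c2 \<le> N"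
    unfolding N_def t[symmetric] using norm_diff_ineq[of "of_real (1 - \<alpha> / 4) * c1\<^sup>2" c2]
    by (simp add: add.commute)
  then have "(2 - \<alpha> / 4) * x\<^sup>2 - 1 - 3 * x \<le> N - 3 * x"
    using c(2) by (simp add: x_def algebra_simps)
  \<comment> \<open>The vertex of this quadratic is at x = 6 / (8 - \<alpha>), with minimum -1 - 9 /
    (8 - \<alpha>) = -(17 - \<alpha>) / (8 - \<alpha>).\<close>
  moreover have "- ((17 - \<alpha>) / (8 - \<alpha>)) + (8 - \<alpha>) / 4 * (x - 6 / (8 - \<alpha>))\<^sup>2
      = (2 - \<alpha> / 4) * x\<^sup>2 - 1 - 3 * x"
  proof -
    define d where "d = 8 - \<alpha>"
    have d: "d \<noteq> 0" "8 - \<alpha> = d" "17 - \<alpha> = 9 + d" "2 - \<alpha> / 4 = d / 4" using \<alpha> by (auto simp: d_def)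
    have "- ((9 + d) / d) + d / 4 * (x - 6 / d)\<^sup>2 = d / 4 * x\<^sup>2 - 1 - 3 * x"
      using d(1) by (simp add: field_simps power2_eq_square)
    then show ?thesis by (simp only: d)
  qed
  moreover have "0 \<le> (8 - \<alpha>) / 4 * (x - 6 / (8 - \<alpha>))\<^sup>2"
    using \<alpha> by simp
  ultimately have "- ((17 - \<alpha>) / (8 - \<alpha>)) \<le> N - 3 * x" by linarith
  then show "- (\<alpha> * (17 - \<alpha>) / (12 * (8 - \<alpha>))) \<le> norm (log_coeff f 2) - norm (log_coeff f 1)"
    using \<alpha> mult_left_mono[of "- ((17 - \<alpha>) / (8 - \<alpha>))" "N - 3 * x" "\<alpha> / 12"]
    unfolding diff by simp
qed

section \<open>Sharpness of the upper bound\<close>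

lemma class_G_extremal:
  assumes \<alpha>: "0 < \<alpha>"
  shows "\<exists>f \<in> class_G \<alpha>. norm (log_coeff f 2) - norm (log_coeff f 1) = \<alpha> / 12"
proof -
  \<comment> \<open>\<open>F\<close> is the derivative of the function sought. The principal power
    is holomorphic because 1 - z^2 stays in the right half-plane.\<close>
  define F :: "complex \<Rightarrow> complex" where "F = (\<lambda>z. (1 - z\<^sup>2) powr of_real (\<alpha> / 2))"
  have sq: "norm (z\<^sup>2) < 1" if "norm z < 1" for z :: complex
    using that by (simp add: norm_power power_less_one_iff)
  have pos: "Re (1 - z\<^sup>2) > 0" if "norm z < 1" for z :: complex
    using sq[OF that] complex_Re_le_cmod[of "z\<^sup>2"] by (simp only: minus_complex.simps one_complex.simps)
  have npos: "1 - z\<^sup>2 \<notin> \<real>\<^sub>\<le>\<^sub>0" if "norm z < 1" for z :: complex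
    using pos[OF that] by (auto simp: complex_nonpos_Reals_iff)
  have nz1: "1 - z\<^sup>2 \<noteq> 0" if "norm z < 1" for z :: complex
    using npos[OF that] by auto
  have dF: "(F has_field_derivative - \<alpha> * z / (1 - z\<^sup>2) * F z) (at z)" if "norm z < 1" for z :: complex
    unfolding F_def
    by (rule derivative_eq_intros npos[OF that] refl)+
       (use nz1[OF that] in \<open>simp only: powr_diff, simp add: field_simps\<close>)
  have Fhol: "F holomorphic_on ball 0 1"
    using dF unfolding holomorphic_on_open[OF open_ball] by (metis mem_ball_0)
  \<comment> \<open>The disc is convex, so \<open>F\<close> has a primitive; subtracting its value
    at 0 normalises it.\<close>
  obtain f0 where f0: "\<And>z. z \<in> ball 0 1 \<Longrightarrow> (f0 has_field_derivative F z) (at z within ball 0 1)"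
    using holomorphic_convex_primitive'[OF convex_ball open_ball Fhol] by blast
  define f where "f = (\<lambda>z. f0 z - f0 0)"
  have df: "(f has_field_derivative F z) (at z)" if "norm z < 1" for z :: complex
    unfolding f_def using f0[of z] that
    by (auto simp: at_within_open[of z "ball 0 1"] intro!: derivative_eq_intros)
  have d1: "deriv f z = F z" if "norm z < 1" for z :: complex
    using df[OF that] by (rule DERIV_imp_deriv)
  have F0: "F 0 = 1" by (simp add: F_def)
  have Fnz: "F z \<noteq> 0" if "norm z < 1" for z :: complex
    using nz1[OF that] by (simp add: F_def)
  have A: "f \<in> class_A"
  proof -
    have "f holomorphic_on ball 0 1"
      using df unfolding holomorphic_on_open[OF open_ball] by (metis mem_ball_0)
    moreover have "f 0 = 0" by (simp add: f_def)
    ultimately show ?thesis using d1[of 0] F0 by (simp add: class_A_def)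
  qed
  have d2: "deriv (deriv f) z = - \<alpha> * z / (1 - z\<^sup>2) * F z" if "norm z < 1" for z :: complex
  proof -
    have "deriv (deriv f) z = deriv F z"
      using eventually_nhds_in_open[of "ball 0 1" z] d1 that
      by (intro deriv_cong_ev refl) (auto elim: eventually_mono)
    then show ?thesis using DERIV_imp_deriv[OF dF[OF that]] by simp
  qed
  have quot: "deriv (deriv f) z / deriv f z = - \<alpha> * z / (1 - z\<^sup>2)" if "norm z < 1" for z :: complex
    using that by (simp add: d1 d2 Fnz)
  have nz: "deriv f z \<noteq> 0" if "norm z < 1" for z :: complex
    using that by (simp add: d1 Fnz)
  have re: "Re (1 + z * deriv (deriv f) z / deriv f z) < 1 + \<alpha> / 2" if z: "norm z < 1" for z :: complex
  proof -
    \<comment> \<open>Inversion maps the disc |w - 1| < 1 into the half-plane Re > 1/2, and z f''/f'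
      equals \<alpha> (1 - 1/w).\<close>
    define w where "w = 1 - z\<^sup>2"
    have wnz: "w \<noteq> 0" using nz1[OF z] by (simp add: w_def)
    have "(norm (1 - w))\<^sup>2 < 1" using sq[OF z] by (simp add: w_def power_less_one_iff)
    then have "(norm w)\<^sup>2 < 2 * Re w"
      unfolding cmod_power2 by (simp add: power2_eq_square algebra_simps)
    then have gt: "1 / 2 < Re (1 / w)"
      using wnz by (simp add: Re_divide' field_simps)
    have "z * deriv (deriv f) z / deriv f z = z * (- \<alpha> * z / w)"
      using quot[OF z] by (simp only: w_def times_divide_eq_right[symmetric])
    also have "\<dots> = - \<alpha> * (1 - w) / w" by (simp add: w_def power2_eq_square)
    also have "\<dots> = \<alpha> * (1 - 1 / w)" using wnz by (simp add: field_simps)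
    finally have "z * deriv (deriv f) z / deriv f z = \<alpha> * (1 - 1 / w)" .
    then have "Re (1 + z * deriv (deriv f) z / deriv f z) = 1 + \<alpha> * (1 - Re (1 / w))"
      by simp
    also have "\<dots> < 1 + \<alpha> / 2"
      using mult_strict_left_mono[OF gt \<alpha>] by (simp add: algebra_simps)
    finally show ?thesis .
  qed
  have G: "f \<in> class_G \<alpha>"
    using A nz re by (auto simp: class_G_def)
  have "((\<lambda>z::complex. - \<alpha> * z / (1 - z\<^sup>2)) has_field_derivative - of_real \<alpha>) (at 0)"
    by (rule derivative_eq_intros refl | simp)+
  then have "deriv (\<lambda>z::complex. - \<alpha> * z / (1 - z\<^sup>2)) 0 = - of_real \<alpha>"
    by (rule DERIV_imp_deriv)
  moreover have "deriv (\<lambda>z. deriv (deriv f) z / deriv f z) 0 = deriv (\<lambda>z::complex. - \<alpha> * z / (1 - z\<^sup>2)) 0"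
    using eventually_nhds_in_open[of "ball 0 1" "0::complex"] quot
    by (intro deriv_cong_ev refl) (auto elim: eventually_mono)
  ultimately have "deriv (\<lambda>z. deriv (deriv f) z / deriv f z) 0 = - of_real \<alpha>" by simp
  \<comment> \<open>Here f''/f' = -\<alpha> z / (1 - z^2) vanishes at 0, so only its derivative
    -\<alpha> contributes.\<close>
  then have "log_coeff f 1 = 0" "log_coeff f 2 = - of_real \<alpha> / 12"
    using log_coeff_pre_schwarzian(2,3)[OF A nz] quot[of 0] by simp_all
  then have "norm (log_coeff f 2) - norm (log_coeff f 1) = \<alpha> / 12"
    using \<alpha> by (simp add: norm_divide)
  with G show ?thesis by blast
qed

theorem theorem5:
  fixes \<alpha> :: real
  assumes "0 < \<alpha>" and "\<alpha> \<le> 1"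
  shows "(\<forall>f \<in> class_G \<alpha>.
            - (\<alpha> * (17 - \<alpha>) / (12 * (8 - \<alpha>))) \<le> cmod (log_coeff f 2) - cmod (log_coeff f 1) \<and>
            cmod (log_coeff f 2) - cmod (log_coeff f 1) \<le> \<alpha> / 12) \<and>
         (\<exists>f \<in> class_G \<alpha>. cmod (log_coeff f 2) - cmod (log_coeff f 1) = \<alpha> / 12)"
  using class_G_log_coeff_bounds[OF assms] class_G_extremal[OF assms(1)] by blast

end
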